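(* Let $0<\lambda<\frac13$ and let $C_\lambda\subset\mathbb{R}$ be the attractor of the system $\mathcal{F}=\{f_1,f_2\}$, where $$f_1(x)=\lambda x\qquad\text{and}\qquad f_2(x)=\lambda x+(1-\lambda).$$ Then $C_\lambda$ (that is, the system $\mathcal{F}$) satisfies the weak separation condition for differences.
   Context: The attractor of $\{f_1,f_2\}$ is the unique non-empty compact $K\subset\mathbb{R}$ with $K=f_1(K)\cup f_2(K)$; here $K=C_\lambda$, a symmetric Cantor set. The contraction ratios are $c_1=c_2=\lambda$. $A-B=\{a-b:a\in A,b\in B\}$. Words: $\mathcal{I}=\{1,2\}$, $\mathcal{I}^*=\bigcup_{k\ge1}\mathcal{I}^k$. For $\alpha=(i_1,\dots,i_k)\in\mathcal{I}^*$, $f_\alpha=f_{i_1}\circ\cdots\circ f_{i_k}$, $c_\alpha=c_{i_1}\cdots c_{i_k}$, $\bar\alpha=(i_1,\dots,i_{k-1})$ (with $c_{\bar\alpha}=1$ if $k=1$). For $0<b<1$, $I_b=\{\alpha\in\mathcal{I}^*: c_\alpha\le b<c_{\bar\alpha}\}$. Weak separation condition for differences: there exist $M\in\mathbb{N}$, $\epsilon>0$ and points $x_0,\dots,x_M\in K$ such that for every $0<b<1$ and all $\alpha,\beta,\gamma,\delta\in I_b$, either $f_\alpha(K)-f_\beta(K)=f_\gamma(K)-f_\delta(K)$ as sets, or $|f_\alpha(x_i)-f_\beta(x_j)-f_\gamma(x_i)+f_\delta(x_j)|\ge\epsilon b$ for some $i,j\le M$ depending on $\alpha,\beta,\gamma,\delta$.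 *)

theory Defs
  imports "HOL-Analysis.Analysis"
begin

text \<open>
  An iterated function system on the real line is given by a finite index set \<open>I\<close>, a family of
  maps \<open>f\<close> and the family \<open>c\<close> of their contraction ratios.
\<close>

definition is_attractor :: "'i set \<Rightarrow> ('i \<Rightarrow> real \<Rightarrow> real) \<Rightarrow> real set \<Rightarrow> bool" where
  "is_attractor I f K \<longleftrightarrow> K \<noteq> {} \<and> compact K \<and> K = (\<Union>i\<in>I. f i ` K)"

text \<open>Meaningful only if the system has a unique attractor; for
  \<open>cantor_map lam\<close> with \<open>0 < lam < 1\<close> this is lemma \<open>cantor_attractor_ex1\<close>.\<close>

definition attractor :: "'i set \<Rightarrow> ('i \<Rightarrow> real \<Rightarrow> real) \<Rightarrow> real set" where
  "attractor I f = (THE K. is_attractor I f K)"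

definition word_map :: "('i \<Rightarrow> real \<Rightarrow> real) \<Rightarrow> 'i list \<Rightarrow> real \<Rightarrow> real" where
  "word_map f \<alpha> = foldr (\<lambda>i g. f i \<circ> g) \<alpha> id"

definition word_ratio :: "('i \<Rightarrow> real) \<Rightarrow> 'i list \<Rightarrow> real" where
  "word_ratio c \<alpha> = prod_list (map c \<alpha>)"

definition cut_words :: "'i set \<Rightarrow> ('i \<Rightarrow> real) \<Rightarrow> real \<Rightarrow> 'i list set" where
  "cut_words I c b =
     {\<alpha>. \<alpha> \<noteq> [] \<and> set \<alpha> \<subseteq> I \<and> word_ratio c \<alpha> \<le> b \<and> b < word_ratio c (butlast \<alpha>)}"

text \<open>The arithmetic difference; the library's \<open>-\<close> on sets is the set-theoretic one.\<close>

definition difference_set :: "real set \<Rightarrow> real set \<Rightarrow> real set" where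
  "difference_set A B = {a - b | a b. a \<in> A \<and> b \<in> B}"

definition weak_separation_differences ::
    "'i set \<Rightarrow> ('i \<Rightarrow> real \<Rightarrow> real) \<Rightarrow> ('i \<Rightarrow> real) \<Rightarrow> bool" where
  "weak_separation_differences I f c \<longleftrightarrow>
     (\<exists>(M::nat) (\<epsilon>::real) (x::nat \<Rightarrow> real).
        \<epsilon> > 0 \<and> (\<forall>i\<le>M. x i \<in> attractor I f) \<and>
        (\<forall>b. 0 < b \<and> b < 1 \<longrightarrow>
          (\<forall>\<alpha>\<in>cut_words I c b. \<forall>\<beta>\<in>cut_words I c b. \<forall>\<gamma>\<in>cut_words I c b. \<forall>\<delta>\<in>cut_words I c b.
             difference_set (word_map f \<alpha> ` attractor I f) (word_map f \<beta> ` attractor I f) =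
             difference_set (word_map f \<gamma> ` attractor I f) (word_map f \<delta> ` attractor I f)
             \<or> (\<exists>i\<le>M. \<exists>j\<le>M.
                  \<bar>word_map f \<alpha> (x i) - word_map f \<beta> (x j)
                   - word_map f \<gamma> (x i) + word_map f \<delta> (x j)\<bar> \<ge> \<epsilon> * b))))"

text \<open>Only the indices \<open>1\<close> and \<open>2\<close> are used.\<close>

definition cantor_map :: "real \<Rightarrow> nat \<Rightarrow> real \<Rightarrow> real" where
  "cantor_map lam i x = (if i = 1 then lam * x else lam * x + (1 - lam))"

lemma attractor_subset:
  fixes f :: "'i \<Rightarrow> real \<Rightarrow> real"
  assumes K: "is_attractor I f K" and L: "is_attractor I f L"
    and l: "0 \<le> l" "l < 1"
    and contr: "\<And>i x y. i \<in> I \<Longrightarrow> dist (f i x) (f i y) \<le> l * dist x y"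
  shows "K \<subseteq> L"
proof -
  have K': "K \<noteq> {}" "compact K" "K = (\<Union>i\<in>I. f i ` K)"
    and L': "L \<noteq> {}" "compact L" "L = (\<Union>i\<in>I. f i ` L)"
    using K L unfolding is_attractor_def by blast+
  have cL: "closed L" using L'(2) compact_imp_closed by blast
  have "continuous_on K (\<lambda>x. infdist x L)" by (intro continuous_intros)
  then obtain x where x: "x \<in> K" "\<And>y. y \<in> K \<Longrightarrow> infdist y L \<le> infdist x L"
    using continuous_attains_sup[OF K'(2,1)] by metis
  obtain i z where iz: "i \<in> I" "z \<in> K" "x = f i z" using x(1) K'(3) by blast
  obtain w where w: "w \<in> L" "infdist z L = dist z w"
    using infdist_attains_inf[OF cL L'(1)] by metis
  have "f i w \<in> L" using w(1) iz(1) L'(3) by blast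
  then have "infdist x L \<le> dist (f i z) (f i w)" using iz(3) infdist_le by blast
  also have "\<dots> \<le> l * infdist z L" using contr[OF iz(1)] w(2) by simp
  also have "\<dots> \<le> l * infdist x L" using x(2)[OF iz(2)] l(1) by (rule mult_left_mono)
  finally have "(1 - l) * infdist x L \<le> 0" by (simp add: algebra_simps)
  then have 0: "infdist x L \<le> 0" using l(2) by (simp add: mult_le_0_iff)
  show ?thesis
  proof
    fix y assume "y \<in> K"
    then have "infdist y L = 0" using x(2) 0 infdist_nonneg[of y L] by fastforce
    then show "y \<in> L" using in_closed_iff_infdist_zero[OF cL L'(1)] by blast
  qed
qed

lemma cantor_attractor_ex1:
  assumes l: "0 < l" "l < 1"
  shows "\<exists>!K. is_attractor {1, 2} (cantor_map l) K"
proof (rule ex_ex1I)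
  fix K L assume "is_attractor {1, 2} (cantor_map l) K" "is_attractor {1, 2} (cantor_map l) L"
  moreover have "dist (cantor_map l i x) (cantor_map l i y) \<le> l * dist x y" for i x y
    using l by (simp add: cantor_map_def dist_real_def abs_mult flip: right_diff_distrib)
  ultimately show "K = L"
    using l by (intro equalityI attractor_subset[of "{1, 2}" "cantor_map l" _ _ l]) simp_all
next
  define F where "F = (\<lambda>A. cantor_map l 1 ` A \<union> cantor_map l 2 ` A)"
  define G where "G = (\<lambda>n. (F ^^ n) {0..1::real})"
  define K where "K = (\<Inter>n. G n)"
  have G_Suc: "G (Suc n) = F (G n)" for n by (simp add: G_def)
  have mono: "F A \<subseteq> F B" if "A \<subseteq> B" for A B using that by (auto simp: F_def)
  have dec1: "G (Suc n) \<subseteq> G n" for n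
  proof (induction n)
    case 0
    have "0 \<le> l * x \<and> l * x \<le> l" if "0 \<le> x" "x \<le> 1" for x
      using that l by (simp add: mult_left_le)
    then show ?case using l
      by (auto simp: G_def F_def cantor_map_def)
  next
    case (Suc n) then show ?case using mono[OF Suc] by (simp only: G_Suc)
  qed
  have dec: "G n \<subseteq> G m" if "m \<le> n" for m n
    using lift_Suc_antimono_le[of G, OF dec1 that] .
  have cmp: "compact (G n)" for n
  proof (induction n)
    case 0 show ?case by (simp add: G_def)
  next
    case (Suc n)
    have "continuous_on (G n) (cantor_map l i)" for i
      by (cases "i = 1") (auto simp: cantor_map_def[abs_def] intro!: continuous_intros)
    then show ?case unfolding G_Suc F_def using Suc
      by (intro compact_Un compact_continuous_image) auto
  qed
  have zero: "0 \<in> G n" for n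
  proof (induction n)
    case 0 show ?case by (simp add: G_def)
  next
    case (Suc n)
    have "cantor_map l 1 0 \<in> G (Suc n)" unfolding G_Suc F_def using Suc by blast
    then show ?case by (simp add: cantor_map_def)
  qed
  have inj: "inj (cantor_map l i)" for i
    using l by (auto simp: inj_def cantor_map_def)
  have "K \<subseteq> F K"
  proof
    fix y assume y: "y \<in> K"
    show "y \<in> F K"
    proof (rule ccontr)
      assume n: "y \<notin> F K"
      have ex: "\<exists>n. y \<notin> cantor_map l i ` G n" if "i \<in> {1, 2}" for i
      proof (rule ccontr)
        assume "\<nexists>n. y \<notin> cantor_map l i ` G n"
        then have "y \<in> (\<Inter>n. cantor_map l i ` G n)" by blast
        then have "y \<in> cantor_map l i ` K"
          unfolding K_def using image_INT[OF inj, of UNIV G] by simp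
        then show False using n that by (auto simp: F_def)
      qed
      obtain p q where pq: "y \<notin> cantor_map l 1 ` G p" "y \<notin> cantor_map l 2 ` G q"
        using ex[of 1] ex[of 2] by auto
      have "y \<in> G (Suc (max p q))" using y by (auto simp: K_def)
      moreover have "G (max p q) \<subseteq> G p" "G (max p q) \<subseteq> G q" by (simp_all add: dec)
      ultimately show False using pq unfolding G_Suc F_def by blast
    qed
  qed
  moreover have "F K \<subseteq> K"
  proof -
    have "F K \<subseteq> G n" for n
    proof -
      have "F K \<subseteq> F (G n)" by (rule mono) (auto simp: K_def)
      then show ?thesis using dec1[of n] G_Suc by blast
    qed
    then show ?thesis unfolding K_def by blast
  qed
  ultimately have "K = F K" by blast
  moreover have "K \<noteq> {}" using zero by (auto simp: K_def)
  moreover have "compact K" unfolding K_def by (rule compact_Inter) (use cmp in auto)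
  moreover have "F K = (\<Union>i\<in>{1, 2}. cantor_map l i ` K)" by (simp add: F_def)
  ultimately show "\<exists>K. is_attractor {1, 2} (cantor_map l) K"
    unfolding is_attractor_def by metis
qed

end

theory Submission
  imports Defs
begin

text \<open>
  All words of a cut set have the same length \<open>n\<close>, so \<open>f\<^sub>\<alpha>(x) = lam\<^sup>n x + t\<^sub>\<alpha>\<close> with \<open>t\<^sub>\<alpha> = f\<^sub>\<alpha>(0)\<close>, and
  the quantity to be bounded is \<open>D = t\<^sub>\<alpha> - t\<^sub>\<beta> - t\<^sub>\<gamma> + t\<^sub>\<delta>\<close>, whatever the points \<open>x\<^sub>i\<close>. It is \<open>1 - lam\<close> times
  a polynomial in \<open>lam\<close> with coefficients in \<open>{-2,...,2}\<close>, and for \<open>lam < 1/3\<close> the first nonzero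
  coefficient dominates the rest. So either \<open>D = 0\<close>, and the two difference sets are the same
  translate of \<open>lam\<^sup>n (K - K)\<close>, or \<open>\<bar>D\<bar> \<ge> (1 - 3 lam) lam\<^bsup>n-1\<^esup> \<ge> (1 - 3 lam) b\<close>.
\<close>

lemma word_map_Nil [simp]: "word_map f [] = id"
  and word_map_Cons [simp]: "word_map f (i # \<alpha>) x = f i (word_map f \<alpha> x)"
  by (simp_all add: word_map_def)

lemma word_ratio_const [simp]: "word_ratio (\<lambda>_. r) \<alpha> = r ^ length \<alpha>"
  by (induction \<alpha>) (simp_all add: word_ratio_def)

text \<open>Chaining \<open>r ^ length \<alpha> \<le> b\<close> with
  \<open>b < r ^ (length \<beta> - 1)\<close> gives one inequality between the lengths; swapping the
  words gives the other.\<close>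

lemma length_eq_cut_words_const:
  assumes r: "0 < r" "r < 1"
    and \<alpha>: "\<alpha> \<in> cut_words I (\<lambda>_. r) b" and \<beta>: "\<beta> \<in> cut_words I (\<lambda>_. r) b"
  shows "length \<alpha> = length \<beta>"
proof -
  have "length \<beta> \<le> length \<alpha>"
    if "\<alpha> \<in> cut_words I (\<lambda>_. r) b" "\<beta> \<in> cut_words I (\<lambda>_. r) b" for \<alpha> \<beta>
  proof -
    have "r ^ length \<alpha> < r ^ (length \<beta> - 1)" "\<beta> \<noteq> []"
      using that by (auto simp: cut_words_def)
    then show ?thesis
      using r by simp
  qed
  then show ?thesis using \<alpha> \<beta> by (simp add: order_antisym)
qed

lemma word_map_cantor:
  "word_map (cantor_map lam) \<alpha> x = lam ^ length \<alpha> * x + word_map (cantor_map lam) \<alpha> 0"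
  by (induction \<alpha>) (simp_all add: cantor_map_def algebra_simps)

text \<open>Each map sends the interval [0,1] into itself. This bounds the tail in the gap
  estimate.\<close>

lemma word_map_cantor_bounds:
  assumes "0 \<le> lam" "lam \<le> 1"
  shows "0 \<le> word_map (cantor_map lam) \<alpha> 0 \<and> word_map (cantor_map lam) \<alpha> 0 \<le> 1"
proof (induction \<alpha>)
  case (Cons i \<alpha>)
  let ?t = "word_map (cantor_map lam) \<alpha> 0"
  have "0 \<le> lam * ?t" "lam * ?t \<le> lam"
    using Cons assms by (simp_all add: mult_left_le)
  moreover have "word_map (cantor_map lam) (i # \<alpha>) 0 = lam * ?t + (if i = 1 then 0 else 1 - lam)"
    by (simp only: word_map_Cons cantor_map_def[of lam i ?t]) simp
  ultimately show ?case using assms by simp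
qed simp

text \<open>The factor \<open>lam\<close> on the right stands for the exponent \<open>length \<alpha> - 1\<close>.\<close>

lemma cantor_translation_gap:
  fixes lam :: real
  defines "t \<equiv> \<lambda>\<alpha>. word_map (cantor_map lam) \<alpha> 0"
  assumes lam: "0 < lam" "lam < 1 / 3"
    and len: "length \<alpha> = length \<beta>" "length \<beta> = length \<gamma>" "length \<gamma> = length \<delta>"
  shows "t \<alpha> - t \<beta> - t \<gamma> + t \<delta> = 0 \<or>
    (1 - 3 * lam) * lam ^ length \<alpha> \<le> lam * \<bar>t \<alpha> - t \<beta> - t \<gamma> + t \<delta>\<bar>"
  using len
proof (induction \<alpha> \<beta> \<gamma> \<delta> rule: list_induct4)
  case (Cons a \<alpha> b \<beta> c \<gamma> d \<delta>)
  define D where "D = t \<alpha> - t \<beta> - t \<gamma> + t \<delta>"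
  \<comment> \<open>Integer-valued digits make \<open>g\<close>, the leading coefficient, an
    integer, so \<open>g \<noteq> 0\<close> forces \<open>\<bar>g\<bar> \<ge> 1\<close>.\<close>
  define e where "e = (\<lambda>i::nat. if i = 1 then 0 else 1 :: int)"
  define g where "g = e a - e b - e c + e d"
  have t_Cons: "t (i # \<xi>) = lam * t \<xi> + (1 - lam) * e i" for i \<xi>
    by (simp add: t_def e_def cantor_map_def)
  have D': "t (a # \<alpha>) - t (b # \<beta>) - t (c # \<gamma>) + t (d # \<delta>) = lam * D + (1 - lam) * g"
    by (simp add: t_Cons D_def g_def algebra_simps)
  show ?case
  proof (cases "g = 0")
    \<comment> \<open>With no leading term, prepending the letters multiplies both sides of the
      induction hypothesis by \<open>lam\<close>.\<close>
    case True
    have "(1 - 3 * lam) * lam ^ length \<alpha> \<le> lam * \<bar>D\<bar>" if "D \<noteq> 0"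
      using Cons.IH that by (simp add: D_def)
    then show ?thesis
      unfolding D' using True lam by (auto simp: abs_mult mult_ac)
  next
    case False
    \<comment> \<open>Source of the constant: the leading term is at least \<open>1 - lam\<close> in
      absolute value and the tail at most \<open>2 * lam\<close>, which leaves
      \<open>1 - 3 * lam\<close>.\<close>
    have "0 \<le> t \<xi> \<and> t \<xi> \<le> 1" for \<xi>
      unfolding t_def using word_map_cantor_bounds lam by simp
    then have "\<bar>D\<bar> \<le> 2"
      unfolding D_def by (smt (verit))
    then have "\<bar>lam * D\<bar> \<le> 2 * lam"
      using lam by (simp add: abs_mult)
    moreover have "1 \<le> \<bar>real_of_int g\<bar>"
      using False by linarith
    then have "1 - lam \<le> \<bar>(1 - lam) * g\<bar>"
      using lam by (simp add: abs_mult)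
    ultimately have "1 - 3 * lam \<le> \<bar>lam * D + (1 - lam) * g\<bar>"
      by linarith
    moreover have "(1 - 3 * lam) * lam ^ length \<alpha> \<le> 1 - 3 * lam"
      using lam by (simp add: mult_left_le power_le_one)
    ultimately have "lam * ((1 - 3 * lam) * lam ^ length \<alpha>) \<le> lam * \<bar>lam * D + (1 - lam) * g\<bar>"
      using lam by (intro mult_left_mono) linarith+
    then show ?thesis
      unfolding D' by (simp add: mult.left_commute)
  qed
qed simp

text \<open>A common slope factors out of \<open>f x - g y\<close>, so the two translations enter
  only through \<open>u - v\<close>.\<close>

lemma difference_set_affine:
  assumes "\<And>x. f x = s * x + u" "\<And>x. g x = s * x + v"
  shows "difference_set (f ` A) (g ` B) = (\<lambda>z. s * z + (u - v)) ` difference_set A B"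
proof -
  have "difference_set (f ` A) (g ` B) = {f x - g y |x y. x \<in> A \<and> y \<in> B}"
    unfolding difference_set_def by blast
  also have "\<dots> = {s * (x - y) + (u - v) |x y. x \<in> A \<and> y \<in> B}"
    by (simp add: assms algebra_simps)
  also have "\<dots> = (\<lambda>z. s * z + (u - v)) ` difference_set A B"
    unfolding difference_set_def by blast
  finally show ?thesis .
qed

theorem proposition4p1:
  fixes lam :: real
  assumes "0 < lam" and "lam < 1 / 3"
  shows "weak_separation_differences {1, 2} (cantor_map lam) (\<lambda>_. lam)"
proof -
  let ?K = "attractor {1, 2} (cantor_map lam)"
  let ?w = "word_map (cantor_map lam)"
  have "is_attractor {1, 2} (cantor_map lam) ?K"
    unfolding attractor_def using assms by (intro theI'[OF cantor_attractor_ex1]) simp_all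
  then obtain p where p: "p \<in> ?K"
    unfolding is_attractor_def by blast
  have dichotomy: "difference_set (?w \<alpha> ` ?K) (?w \<beta> ` ?K) = difference_set (?w \<gamma> ` ?K) (?w \<delta> ` ?K)
      \<or> (1 - 3 * lam) * b \<le> \<bar>?w \<alpha> p - ?w \<beta> p - ?w \<gamma> p + ?w \<delta> p\<bar>"
    if w: "\<alpha> \<in> cut_words {1, 2} (\<lambda>_. lam) b" "\<beta> \<in> cut_words {1, 2} (\<lambda>_. lam) b"
      "\<gamma> \<in> cut_words {1, 2} (\<lambda>_. lam) b" "\<delta> \<in> cut_words {1, 2} (\<lambda>_. lam) b"
    for \<alpha> \<beta> \<gamma> \<delta> b
  proof -
    define n where "n = length \<alpha>"
    define D where "D = ?w \<alpha> 0 - ?w \<beta> 0 - ?w \<gamma> 0 + ?w \<delta> 0"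
    have "lam < 1" using assms by simp
    note same_length = length_eq_cut_words_const[OF assms(1) this _ w(1)]
    have len: "length \<alpha> = n" "length \<beta> = n" "length \<gamma> = n" "length \<delta> = n"
      unfolding n_def by (fact refl same_length[OF w(2)] same_length[OF w(3)] same_length[OF w(4)])+
    have map_eq: "?w \<xi> x = lam ^ n * x + ?w \<xi> 0" if "length \<xi> = n" for \<xi> x
      using word_map_cantor[of lam \<xi> x] that by simp
    consider "D = 0" | "(1 - 3 * lam) * lam ^ n \<le> lam * \<bar>D\<bar>"
      unfolding D_def using cantor_translation_gap[OF assms, of \<alpha> \<beta> \<gamma> \<delta>] len by auto
    then show ?thesis
    proof cases
      case 1
      then have "?w \<alpha> 0 - ?w \<beta> 0 = ?w \<gamma> 0 - ?w \<delta> 0"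
        by (simp add: D_def)
      moreover have "difference_set (?w \<xi> ` ?K) (?w \<eta> ` ?K) =
          (\<lambda>z. lam ^ n * z + (?w \<xi> 0 - ?w \<eta> 0)) ` difference_set ?K ?K"
        if "length \<xi> = n" "length \<eta> = n" for \<xi> \<eta>
        using map_eq that by (intro difference_set_affine)
      ultimately show ?thesis
        using len by simp
    next
      case 2
      \<comment> \<open>Words in a cut set are nonempty, so \<open>n - 1\<close> is a true
        predecessor and multiplying by \<open>lam\<close> gives \<open>lam ^ n\<close>.\<close>
      have "b < lam ^ (n - 1)" "0 < n"
        using w(1) len(1) by (auto simp: cut_words_def)
      then have "lam * b \<le> lam ^ n"
        using assms by (simp add: power_eq_if)
      then have "(1 - 3 * lam) * (lam * b) \<le> (1 - 3 * lam) * lam ^ n"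
        using assms by (intro mult_left_mono) simp_all
      also note 2
      finally have "lam * ((1 - 3 * lam) * b) \<le> lam * \<bar>D\<bar>"
        by (simp only: mult_ac)
      then have "(1 - 3 * lam) * b \<le> \<bar>D\<bar>"
        using assms by simp
      \<comment> \<open>The terms \<open>lam ^ n * p\<close> cancel, as the four words have equal
        length.\<close>
      moreover have "?w \<alpha> p - ?w \<beta> p - ?w \<gamma> p + ?w \<delta> p = D"
        using map_eq[of _ p] len by (simp add: D_def)
      ultimately show ?thesis by simp
    qed
  qed
  \<comment> \<open>Since the base point cancels, one point of the attractor suffices:
    \<open>M = 0\<close>.\<close>
  show ?thesis
    unfolding weak_separation_differences_def
  proof (rule exI[of _ "0::nat"], rule exI[of _ "1 - 3 * lam"], rule exI[of _ "\<lambda>_. p"],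
      intro conjI allI impI ballI)
    show "0 < 1 - 3 * lam" using assms by simp
    show "p \<in> ?K" by (fact p)
  qed (use dichotomy in simp)
qed

end
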